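(* Let $M=\mathbb{T}^3$ or a smooth compact $3$-manifold, and for a smooth vector field $w$ on $M$ let $T_wf:=w\cdot\nabla f$ for $f\in C^\infty(M)$. For all smooth vector fields $u,v$ on $M$, one has on $C^\infty(M)$ the identity $$[T_u,T_v]=T_{[u,v]},\qquad [u,v]:=u\cdot\nabla v-v\cdot\nabla u.$$
   Context: $T_wf=w\cdot\nabla f$ is the derivative of $f$ along $w$; in local coordinates $T_wf=\sum_i w^i\partial_i f$. The bracket $[T_u,T_v]$ is the operator commutator $T_uT_v-T_vT_u$. The vector field $[u,v]=u\cdot\nabla v-v\cdot\nabla u$ is the Lie bracket, given in local coordinates by $[u,v]^i=\sum_j\big(u^j\partial_jv^i-v^j\partial_ju^i\big)$. *)

theory Defs
  imports "HOL-Analysis.Analysis"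
begin

section \<open>Smooth real-valued functions on open subsets of three-dimensional space\<close>

definition partial :: "3 \<Rightarrow> (real^3 \<Rightarrow> real) \<Rightarrow> real^3 \<Rightarrow> real" where
  "partial i f x = frechet_derivative f (at x) (axis i 1)"

text \<open>These notions are meant for open sets \<open>S\<close> only: derivatives are taken at \<open>x\<close>, not within \<open>S\<close>.\<close>

fun Ck_on :: "nat \<Rightarrow> (real^3) set \<Rightarrow> (real^3 \<Rightarrow> real) \<Rightarrow> bool" where
  "Ck_on 0 S f \<longleftrightarrow> continuous_on S f"
| "Ck_on (Suc k) S f \<longleftrightarrow> (\<forall>x\<in>S. f differentiable (at x)) \<and> (\<forall>i. Ck_on k S (partial i f))"

definition smooth_on :: "(real^3) set \<Rightarrow> (real^3 \<Rightarrow> real) \<Rightarrow> bool" where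
  "smooth_on S f \<longleftrightarrow> (\<forall>k. Ck_on k S f)"


section \<open>Smooth 3-manifolds\<close>

text \<open>A chart is a pair of its domain and its coordinate map; the coordinate map is arbitrary
  outside the domain.\<close>

type_synonym 'a chart = "'a set \<times> ('a \<Rightarrow> real^3)"

definition chart_on :: "'a topology \<Rightarrow> 'a chart \<Rightarrow> bool" where
  "chart_on X c \<longleftrightarrow> openin X (fst c) \<and> open (snd c ` fst c) \<and>
     homeomorphic_map (subtopology X (fst c)) (top_of_set (snd c ` fst c)) (snd c)"

definition local_rep :: "'a chart \<Rightarrow> ('a \<Rightarrow> real) \<Rightarrow> real^3 \<Rightarrow> real" where
  "local_rep c f = f \<circ> inv_into (fst c) (snd c)"

definition smooth_manifold :: "'a topology \<Rightarrow> 'a chart set \<Rightarrow> bool" where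
  "smooth_manifold X A \<longleftrightarrow>
     Hausdorff_space X \<and> second_countable X \<and>
     (\<forall>c\<in>A. chart_on X c) \<and> (\<Union>c\<in>A. fst c) = topspace X \<and>
     (\<forall>c\<in>A. \<forall>d\<in>A. \<forall>i.
        smooth_on (snd c ` (fst c \<inter> fst d)) (local_rep c (\<lambda>p. snd d p $ i)))"

definition compact_smooth_manifold :: "'a topology \<Rightarrow> 'a chart set \<Rightarrow> bool" where
  "compact_smooth_manifold X A \<longleftrightarrow> compact_space X \<and> smooth_manifold X A"


section \<open>Smooth functions, vector fields, derivatives along vector fields\<close>

definition smooth_functions :: "'a chart set \<Rightarrow> ('a \<Rightarrow> real) set" where
  "smooth_functions A = {f. \<forall>c\<in>A. smooth_on (snd c ` fst c) (local_rep c f)}"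

definition chart_partial :: "'a chart \<Rightarrow> 3 \<Rightarrow> ('a \<Rightarrow> real) \<Rightarrow> 'a \<Rightarrow> real" where
  "chart_partial c i f p = partial i (local_rep c f) (snd c p)"

text \<open>A vector field is given by its components \<open>w c p $ i\<close> in every chart \<open>c\<close> of the atlas;
  on the overlap of two charts the components are related by the Jacobian matrix
  of the change of coordinates.\<close>

type_synonym 'a vfield = "'a chart \<Rightarrow> 'a \<Rightarrow> real^3"

definition smooth_vector_fields :: "'a chart set \<Rightarrow> 'a vfield set" where
  "smooth_vector_fields A =
     {w. (\<forall>c\<in>A. \<forall>i. smooth_on (snd c ` fst c) (local_rep c (\<lambda>p. w c p $ i))) \<and>
         (\<forall>c\<in>A. \<forall>d\<in>A. \<forall>p\<in>fst c \<inter> fst d. \<forall>i.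
            w d p $ i = (\<Sum>j\<in>UNIV. chart_partial c j (\<lambda>q. snd d q $ i) p * w c p $ j))}"

definition chart_at :: "'a chart set \<Rightarrow> 'a \<Rightarrow> 'a chart" where
  "chart_at A p = (SOME c. c \<in> A \<and> p \<in> fst c)"

text \<open>The value does not depend on the choice of the chart around \<open>p\<close>,
  see \<open>vderiv_in_chart\<close> below.\<close>

definition vderiv :: "'a chart set \<Rightarrow> 'a vfield \<Rightarrow> ('a \<Rightarrow> real) \<Rightarrow> 'a \<Rightarrow> real" where
  "vderiv A w f p = (let c = chart_at A p in \<Sum>i\<in>UNIV. w c p $ i * chart_partial c i f p)"

definition lie_bracket :: "'a vfield \<Rightarrow> 'a vfield \<Rightarrow> 'a vfield" where
  "lie_bracket u v c p =
     (\<chi> i. \<Sum>j\<in>UNIV. u c p $ j * chart_partial c j (\<lambda>q. v c q $ i) p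
                    - v c p $ j * chart_partial c j (\<lambda>q. u c q $ i) p)"

definition commutator ::
  "(('a \<Rightarrow> real) \<Rightarrow> 'a \<Rightarrow> real) \<Rightarrow> (('a \<Rightarrow> real) \<Rightarrow> 'a \<Rightarrow> real) \<Rightarrow> ('a \<Rightarrow> real) \<Rightarrow> 'a \<Rightarrow> real" where
  "commutator P Q f p = P (Q f) p - Q (P f) p"


section \<open>Calculus of smooth functions\<close>

lemma sum_axis: "(\<Sum>k\<in>UNIV. axis i (1::real) $ k * g k) = g (i::3)"
proof -
  have "axis i (1::real) $ k * g k = (if k = i then g k else 0)" for k
    by (simp add: axis_def)
  then show ?thesis by simp
qed

lemma has_derivative_partial:
  assumes "f differentiable (at x)"
  shows "(f has_derivative (\<lambda>h. \<Sum>i\<in>UNIV. h $ i * partial i f x)) (at x)"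
proof -
  let ?D = "frechet_derivative f (at x)"
  have D: "(f has_derivative ?D) (at x)" using assms frechet_derivative_works by blast
  have lin: "linear ?D" using D has_derivative_linear by blast
  have "?D h = (\<Sum>i\<in>UNIV. h $ i * partial i f x)" for h
  proof -
    have "h = (\<Sum>i\<in>UNIV. h $ i *\<^sub>R axis i 1)"
      using basis_expansion[of h] by (simp add: scalar_mult_eq_scaleR)
    then have "?D h = ?D (\<Sum>i\<in>UNIV. h $ i *\<^sub>R axis i 1)" by simp
    also have "\<dots> = (\<Sum>i\<in>UNIV. h $ i * partial i f x)"
      by (simp add: linear_sum[OF lin] linear_cmul[OF lin] partial_def)
    finally show ?thesis .
  qed
  then have "?D = (\<lambda>h. \<Sum>i\<in>UNIV. h $ i * partial i f x)" by (rule ext)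
  with D show ?thesis by simp
qed

lemma partial_eqI: "(f has_derivative D) (at x) \<Longrightarrow> partial i f x = D (axis i 1)"
  unfolding partial_def using frechet_derivative_at by metis

lemma partial_cong:
  assumes "open S" "x \<in> S" "\<And>y. y \<in> S \<Longrightarrow> f y = g y"
  shows "partial i f x = partial i g x"
proof -
  have "(f has_derivative D) (at x) \<longleftrightarrow> (g has_derivative D) (at x)" for D
    using has_derivative_transform_within_open[of f D x UNIV S g]
      has_derivative_transform_within_open[of g D x UNIV S f] assms by auto
  then show ?thesis unfolding partial_def frechet_derivative_def by simp
qed

lemma differentiable_cong_open:
  assumes "open S" "x \<in> S" "\<And>y. y \<in> S \<Longrightarrow> f y = g y" "f differentiable (at x)"
  shows "g differentiable (at x)"
proof -
  obtain D where "(f has_derivative D) (at x)"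
    using assms(4) unfolding differentiable_def by blast
  then have "(g has_derivative D) (at x)"
    by (rule has_derivative_transform_within_open[OF _ assms(1,2,3)])
  then show ?thesis unfolding differentiable_def by blast
qed

lemma Ck_on_cong:
  assumes "open S" "\<And>y. y \<in> S \<Longrightarrow> f y = g y" "Ck_on k S f"
  shows "Ck_on k S g"
  using assms(2,3)
proof (induction k arbitrary: f g)
  case 0
  then show ?case using continuous_on_cong[of S S f g] by simp
next
  case (Suc k)
  have f: "f differentiable (at x)" if "x \<in> S" for x
    using Suc.prems(2) that by simp
  have "g differentiable (at x)" if "x \<in> S" for x
    by (rule differentiable_cong_open[OF \<open>open S\<close> that Suc.prems(1) f[OF that]])
  moreover have "Ck_on k S (partial i g)" for i
  proof (rule Suc.IH)
    show "partial i f y = partial i g y" if "y \<in> S" for y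
      by (rule partial_cong[OF \<open>open S\<close> that Suc.prems(1)])
    show "Ck_on k S (partial i f)" using Suc.prems(2) by simp
  qed
  ultimately show ?case by simp
qed

lemma Ck_on_subset: "Ck_on k S f \<Longrightarrow> T \<subseteq> S \<Longrightarrow> Ck_on k T f"
proof (induction k arbitrary: f)
  case 0
  then show ?case using continuous_on_subset by (simp only: Ck_on.simps)
next
  case (Suc k)
  then show ?case by (simp add: subset_iff)
qed

lemma Ck_on_Suc: "Ck_on (Suc k) S f \<Longrightarrow> Ck_on k S f"
proof (induction k arbitrary: f)
  case 0
  then have d: "f differentiable (at x)" if "x \<in> S" for x
    using that by (simp only: Ck_on.simps)
  have "isCont f x" if "x \<in> S" for x
    by (rule differentiable_imp_continuous_within[OF d[OF that]])
  then show ?case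
    by (simp only: Ck_on.simps) (rule continuous_at_imp_continuous_on, blast)
next
  case (Suc k)
  have d: "\<forall>x\<in>S. f differentiable (at x)" and p: "Ck_on (Suc k) S (partial i f)" for i
    using Suc.prems unfolding Ck_on.simps(2)[of "Suc k"] by blast+
  show ?case
    unfolding Ck_on.simps(2)[of k S f] using d Suc.IH[OF p] by (intro conjI allI)
qed

lemma partial_add:
  assumes "f differentiable (at x)" "g differentiable (at x)"
  shows "partial i (\<lambda>y. f y + g y) x = partial i f x + partial i g x"
  using partial_eqI[OF has_derivative_add[OF has_derivative_partial[OF assms(1)]
      has_derivative_partial[OF assms(2)]], of i] by (simp add: sum_axis)

lemma partial_mult:
  assumes "f differentiable (at x)" "g differentiable (at x)"
  shows "partial i (\<lambda>y. f y * g y) x = f x * partial i g x + partial i f x * g x"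
  using partial_eqI[OF has_derivative_mult[OF has_derivative_partial[OF assms(1)]
      has_derivative_partial[OF assms(2)]], of i] by (simp add: sum_axis)

lemma partial_const: "partial i (\<lambda>_. a) = (\<lambda>_. 0)"
  using partial_eqI[OF has_derivative_const] by fastforce

lemma Ck_on_const: "Ck_on k S (\<lambda>_. a)"
  by (induction k arbitrary: a) (auto simp: partial_const)

lemma Ck_on_add:
  assumes "open S" "Ck_on k S f" "Ck_on k S g"
  shows "Ck_on k S (\<lambda>y. f y + g y)"
  using assms
proof (induction k arbitrary: f g)
  case 0
  then show ?case by (auto intro: continuous_on_add)
next
  case (Suc k)
  have "Ck_on k S (partial i (\<lambda>y. f y + g y))" for i
    by (rule Ck_on_cong[OF \<open>open S\<close> _ Suc.IH[of "partial i f" "partial i g"]])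
      (use Suc.prems in \<open>auto simp: partial_add\<close>)
  with Suc.prems show ?case by auto
qed

lemma Ck_on_mult:
  assumes "open S" "Ck_on k S f" "Ck_on k S g"
  shows "Ck_on k S (\<lambda>y. f y * g y)"
  using assms
proof (induction k arbitrary: f g)
  case 0
  then show ?case by (auto intro: continuous_on_mult)
next
  case (Suc k)
  have "Ck_on k S (\<lambda>y. f y * partial i g y + partial i f y * g y)" for i
    using Suc.prems Ck_on_Suc by (intro Ck_on_add Suc.IH) auto
  then have "Ck_on k S (partial i (\<lambda>y. f y * g y))" for i
    by (rule Ck_on_cong[OF \<open>open S\<close>, rotated]) (use Suc.prems in \<open>auto simp: partial_mult\<close>)
  with Suc.prems show ?case by auto
qed

lemma smooth_on_cong:
  "open S \<Longrightarrow> (\<And>y. y \<in> S \<Longrightarrow> f y = g y) \<Longrightarrow> smooth_on S f \<Longrightarrow> smooth_on S g"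
  unfolding smooth_on_def using Ck_on_cong by blast

lemma smooth_on_subset: "smooth_on S f \<Longrightarrow> T \<subseteq> S \<Longrightarrow> smooth_on T f"
  unfolding smooth_on_def using Ck_on_subset by blast

lemma smooth_on_const: "smooth_on S (\<lambda>_. a)"
  unfolding smooth_on_def using Ck_on_const by blast

lemma smooth_on_add:
  "open S \<Longrightarrow> smooth_on S f \<Longrightarrow> smooth_on S g \<Longrightarrow> smooth_on S (\<lambda>y. f y + g y)"
  unfolding smooth_on_def using Ck_on_add by blast

lemma smooth_on_mult:
  "open S \<Longrightarrow> smooth_on S f \<Longrightarrow> smooth_on S g \<Longrightarrow> smooth_on S (\<lambda>y. f y * g y)"
  unfolding smooth_on_def using Ck_on_mult by blast

lemma smooth_on_diff:
  assumes "open S" "smooth_on S f" "smooth_on S g"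
  shows "smooth_on S (\<lambda>y. f y - g y)"
  using smooth_on_add[OF assms(1,2) smooth_on_mult[OF assms(1) smooth_on_const[of S "-1"] assms(3)]]
  by simp

lemma smooth_on_sum:
  "open S \<Longrightarrow> (\<And>i. i \<in> I \<Longrightarrow> smooth_on S (f i)) \<Longrightarrow> smooth_on S (\<lambda>y. \<Sum>i\<in>I. f i y)"
  by (induction I rule: infinite_finite_induct)
    (auto intro: smooth_on_const smooth_on_add)

lemma smooth_on_partial: "smooth_on S f \<Longrightarrow> smooth_on S (partial i f)"
  unfolding smooth_on_def
proof
  fix k assume "\<forall>k. Ck_on k S f"
  then have "Ck_on (Suc k) S f" by blast
  then show "Ck_on k S (partial i f)" by simp
qed

lemma smooth_on_differentiable:
  assumes "smooth_on S f" "x \<in> S"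
  shows "f differentiable (at x)"
proof -
  have "Ck_on (Suc 0) S f" using assms(1) unfolding smooth_on_def by blast
  with assms(2) show ?thesis by simp
qed

lemma smooth_on_continuous:
  assumes "smooth_on S f"
  shows "continuous_on S f"
proof -
  have "Ck_on 0 S f" using assms unfolding smooth_on_def by blast
  then show ?thesis by simp
qed

lemma has_derivative_cartI:
  fixes g :: "'b::real_normed_vector \<Rightarrow> real^3"
  assumes "\<And>k. ((\<lambda>x. g x $ k) has_derivative (\<lambda>h. g' h $ k)) (at x)"
  shows "(g has_derivative g') (at x)"
  using assms unfolding has_derivative_componentwise_within[of g g' x UNIV]
  by (auto simp: Basis_vec_def inner_axis)

lemma partial_sum:
  assumes "finite I" "\<And>j. j \<in> I \<Longrightarrow> f j differentiable (at x)"
  shows "partial i (\<lambda>y. \<Sum>j\<in>I. f j y) x = (\<Sum>j\<in>I. partial i (f j) x)"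
  using assms
  by (induction I rule: finite_induct) (auto simp: partial_const partial_add)

lemma has_real_derivative_line:
  assumes "f differentiable (at (a + t *\<^sub>R axis i 1))"
  shows "((\<lambda>s. f (a + s *\<^sub>R axis i 1)) has_real_derivative partial i f (a + t *\<^sub>R axis i 1)) (at t)"
proof -
  let ?b = "a + t *\<^sub>R axis i 1 :: real^3"
  have l: "((\<lambda>s. a + s *\<^sub>R axis i 1) has_derivative (\<lambda>h. h *\<^sub>R axis i 1)) (at t)"
    by (auto intro!: derivative_eq_intros)
  have "((\<lambda>s. f (a + s *\<^sub>R axis i 1)) has_derivative
      (\<lambda>h. \<Sum>k\<in>UNIV. (h *\<^sub>R axis i 1) $ k * partial k f ?b)) (at t)"
    using has_derivative_compose[OF l has_derivative_partial[OF assms]] by simp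
  moreover have "(\<lambda>h. \<Sum>k\<in>UNIV. (h *\<^sub>R axis i 1) $ k * partial k f ?b) = (*) (partial i f ?b)"
    by (rule ext) (simp add: sum_axis mult.assoc mult.commute flip: sum_distrib_left)
  ultimately show ?thesis unfolding has_field_derivative_def by simp
qed

lemma second_difference:
  assumes S: "cball x (2 * h) \<subseteq> S" and h: "h > 0" and f: "smooth_on S f"
  obtains y where "dist x y \<le> 2 * h"
    "f (x + h *\<^sub>R axis i 1 + h *\<^sub>R axis j 1) - f (x + h *\<^sub>R axis i 1) - f (x + h *\<^sub>R axis j 1) + f x
       = h\<^sup>2 * partial j (partial i f) y"
proof -
  have inS: "x + s *\<^sub>R axis i 1 + t *\<^sub>R axis j 1 \<in> cball x (2 * h)"
    if "0 \<le> s" "s \<le> h" "0 \<le> t" "t \<le> h" for s t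
  proof -
    let ?w = "s *\<^sub>R axis i 1 + t *\<^sub>R axis j 1 :: real^3"
    have "norm ?w \<le> norm (s *\<^sub>R axis i 1 :: real^3) + norm (t *\<^sub>R axis j 1 :: real^3)"
      by (rule norm_triangle_ineq)
    also have "\<dots> \<le> 2 * h" using that by simp
    finally have "x + ?w \<in> cball x (2 * h)" unfolding mem_cball_0[symmetric] by (simp add: dist_norm)
    then show ?thesis by (simp only: add.assoc)
  qed
  define G where "G s = f (x + s *\<^sub>R axis i 1 + h *\<^sub>R axis j 1) - f (x + s *\<^sub>R axis i 1)" for s
  define G' where "G' s = partial i f (x + s *\<^sub>R axis i 1 + h *\<^sub>R axis j 1)
      - partial i f (x + s *\<^sub>R axis i 1)" for s
  have "(G has_real_derivative G' s) (at s)" if "0 \<le> s" "s \<le> h" for s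
  proof -
    have "((\<lambda>s. f ((x + h *\<^sub>R axis j 1) + s *\<^sub>R axis i 1)) has_real_derivative
        partial i f ((x + h *\<^sub>R axis j 1) + s *\<^sub>R axis i 1)) (at s)"
      using inS[of s h] S that h f
      by (intro has_real_derivative_line smooth_on_differentiable[of S]) (auto simp: algebra_simps)
    moreover have "((\<lambda>s. f (x + s *\<^sub>R axis i 1)) has_real_derivative
        partial i f (x + s *\<^sub>R axis i 1)) (at s)"
      using inS[of s 0] S that h f
      by (intro has_real_derivative_line smooth_on_differentiable[of S]) auto
    ultimately show ?thesis unfolding G_def G'_def
      by (auto intro!: DERIV_diff simp: algebra_simps)
  qed
  then obtain s where s: "0 < s" "s < h" "G h - G 0 = (h - 0) * G' s"
    using MVT2[OF h, of G G'] by auto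
  have "((\<lambda>t. partial i f ((x + s *\<^sub>R axis i 1) + t *\<^sub>R axis j 1)) has_real_derivative
        partial j (partial i f) ((x + s *\<^sub>R axis i 1) + t *\<^sub>R axis j 1)) (at t)"
    if "0 \<le> t" "t \<le> h" for t
    using inS[of s t] S that s f
    by (intro has_real_derivative_line smooth_on_differentiable[of S] smooth_on_partial) auto
  from MVT2[OF h this] obtain t where t: "0 < t" "t < h"
    "G' s = h * partial j (partial i f) (x + s *\<^sub>R axis i 1 + t *\<^sub>R axis j 1)"
    unfolding G'_def by auto
  show ?thesis
    by (rule that[of "x + s *\<^sub>R axis i 1 + t *\<^sub>R axis j 1"])
      (use inS[of s t] s t in \<open>auto simp: G_def power2_eq_square algebra_simps\<close>)
qed

lemma partial_commute:
  assumes "open S" "x \<in> S" and f: "smooth_on S f"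
  shows "partial i (partial j f) x = partial j (partial i f) x"
proof -
  define D where "D y = partial i (partial j f) y" for y
  define E where "E y = partial j (partial i f) y" for y
  have cont: "isCont D x" "isCont E x"
    using smooth_on_continuous[OF smooth_on_partial[OF smooth_on_partial[OF f]]] assms(1,2)
    unfolding D_def E_def by (simp_all add: continuous_on_eq_continuous_at)
  have "\<bar>D x - E x\<bar> \<le> e" if e: "e > 0" for e
  proof -
    obtain r where r: "r > 0" "\<And>y. dist y x < r \<Longrightarrow> dist (D y) (D x) < e / 2"
      using cont(1)[unfolded continuous_at_eps_delta, rule_format, OF half_gt_zero[OF e]] by blast
    obtain r' where r': "r' > 0" "\<And>y. dist y x < r' \<Longrightarrow> dist (E y) (E x) < e / 2"
      using cont(2)[unfolded continuous_at_eps_delta, rule_format, OF half_gt_zero[OF e]] by blast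
    obtain q where q: "q > 0" "cball x q \<subseteq> S" using assms open_contains_cball by blast
    define h where "h = Min {r, r', q} / 4"
    have h: "h > 0" "2 * h < r" "2 * h < r'" "2 * h \<le> q"
      using r(1) r'(1) q(1) unfolding h_def by auto
    have sub: "cball x (2 * h) \<subseteq> S" using subset_cball[OF h(4)] q(2) by (rule order_trans)
    obtain y where y: "dist x y \<le> 2 * h"
      "f (x + h *\<^sub>R axis i 1 + h *\<^sub>R axis j 1) - f (x + h *\<^sub>R axis i 1) - f (x + h *\<^sub>R axis j 1) + f x
         = h\<^sup>2 * E y"
      using second_difference[OF sub h(1) f, of i j] unfolding E_def by metis
    obtain z where z: "dist x z \<le> 2 * h"
      "f (x + h *\<^sub>R axis j 1 + h *\<^sub>R axis i 1) - f (x + h *\<^sub>R axis j 1) - f (x + h *\<^sub>R axis i 1) + f x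
         = h\<^sup>2 * D z"
      using second_difference[OF sub h(1) f, of j i] unfolding D_def by metis
    have eq: "x + h *\<^sub>R axis j 1 + h *\<^sub>R axis i 1 = x + h *\<^sub>R axis i 1 + h *\<^sub>R axis j 1"
      by (simp add: algebra_simps)
    have "h\<^sup>2 * D z = h\<^sup>2 * E y" unfolding y(2)[symmetric] z(2)[symmetric] eq by simp
    then have zy: "D z = E y" using h(1) by simp
    have "dist (E y) (E x) < e / 2"
      by (rule r'(2)) (use y(1) h in \<open>simp add: dist_commute\<close>)
    moreover have "dist (D z) (D x) < e / 2"
      by (rule r(2)) (use z(1) h in \<open>simp add: dist_commute\<close>)
    ultimately show ?thesis unfolding zy dist_real_def by linarith
  qed
  then have "\<bar>D x - E x\<bar> \<le> 0" by (meson dense not_le)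
  then show ?thesis unfolding D_def E_def by simp
qed


section \<open>The operators and the bracket are well defined\<close>

lemma chart_on_inj: "chart_on X c \<Longrightarrow> inj_on (snd c) (fst c)"
proof -
  assume c: "chart_on X c"
  then have "inj_on (snd c) (topspace (subtopology X (fst c)))"
    unfolding chart_on_def homeomorphic_map_def by blast
  then show ?thesis using c openin_subset unfolding chart_on_def
    by (metis topspace_subtopology_subset)
qed

lemma chart_on_inv: "chart_on X c \<Longrightarrow> p \<in> fst c \<Longrightarrow> inv_into (fst c) (snd c) (snd c p) = p"
  using chart_on_inj by (metis inv_into_f_f)

lemma chart_on_open_image:
  assumes c: "chart_on X c" and V: "openin X V"
  shows "open (snd c ` (fst c \<inter> V))"
proof -
  have "openin (subtopology X (fst c)) (fst c \<inter> V)"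
    using V by (metis inf_commute openin_subtopology_Int)
  then have "openin (top_of_set (snd c ` fst c)) (snd c ` (fst c \<inter> V))"
    using c homeomorphic_imp_open_map unfolding chart_on_def open_map_def by blast
  then show ?thesis using c openin_open_trans unfolding chart_on_def by blast
qed

context
  fixes X :: "'a topology" and A :: "'a chart set"
  assumes M: "smooth_manifold X A"
begin

lemma atlas_chart: "c \<in> A \<Longrightarrow> chart_on X c"
  using M unfolding smooth_manifold_def by blast

lemma atlas_open: "c \<in> A \<Longrightarrow> open (snd c ` fst c)"
  using atlas_chart unfolding chart_on_def by blast

lemma atlas_open_overlap: "c \<in> A \<Longrightarrow> d \<in> A \<Longrightarrow> open (snd c ` (fst c \<inter> fst d))"
  using atlas_chart chart_on_open_image unfolding chart_on_def by metis

lemma atlas_smooth_transition: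
  "c \<in> A \<Longrightarrow> d \<in> A \<Longrightarrow> smooth_on (snd c ` (fst c \<inter> fst d)) (local_rep c (\<lambda>p. snd d p $ i))"
  using M unfolding smooth_manifold_def by blast

lemma local_rep_at: "c \<in> A \<Longrightarrow> p \<in> fst c \<Longrightarrow> local_rep c f (snd c p) = f p"
  using chart_on_inv[OF atlas_chart] unfolding local_rep_def by simp

lemma local_rep_chart_partial:
  "c \<in> A \<Longrightarrow> x \<in> snd c ` fst c \<Longrightarrow> local_rep c (chart_partial c i f) x = partial i (local_rep c f) x"
  by (auto simp: local_rep_at chart_partial_def)

lemma chart_partial_cong:
  assumes "c \<in> A" "d \<in> A" "p \<in> fst c \<inter> fst d" "\<And>q. q \<in> fst c \<inter> fst d \<Longrightarrow> f q = g q"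
  shows "chart_partial c i f p = chart_partial c i g p"
  unfolding chart_partial_def
  by (rule partial_cong[OF atlas_open_overlap[OF assms(1,2)]])
    (use assms in \<open>auto simp: local_rep_at\<close>)

lemma chart_partial_transform:
  assumes c: "c \<in> A" and d: "d \<in> A" and p: "p \<in> fst c \<inter> fst d"
    and f: "local_rep d f differentiable (at (snd d p))"
  shows "chart_partial c j f p =
    (\<Sum>k\<in>UNIV. chart_partial c j (\<lambda>q. snd d q $ k) p * chart_partial d k f p)"
proof -
  let ?x = "snd c p"
  define g :: "real^3 \<Rightarrow> real^3" where "g x = (\<chi> k. local_rep c (\<lambda>q. snd d q $ k) x)" for x
  have gp: "g (snd c q) = snd d q" if "q \<in> fst c \<inter> fst d" for q
    using that c by (simp add: g_def local_rep_at vec_eq_iff)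
  have xS: "?x \<in> snd c ` (fst c \<inter> fst d)" using p by blast
  define g' where "g' h = (\<chi> k. \<Sum>i\<in>UNIV. h $ i * partial i (local_rep c (\<lambda>q. snd d q $ k)) ?x)"
    for h :: "real^3"
  have "(g has_derivative g') (at ?x)"
    using has_derivative_partial[OF smooth_on_differentiable[OF atlas_smooth_transition[OF c d] xS]]
    by (intro has_derivative_cartI) (simp add: g_def g'_def)
  from has_derivative_compose[OF this, of "local_rep d f"] has_derivative_partial[OF f]
  have "((\<lambda>x. local_rep d f (g x)) has_derivative
      (\<lambda>h. \<Sum>k\<in>UNIV. g' h $ k * partial k (local_rep d f) (snd d p))) (at ?x)"
    using gp[OF p] by simp
  then have "partial j (\<lambda>x. local_rep d f (g x)) ?x =
      (\<Sum>k\<in>UNIV. g' (axis j 1) $ k * partial k (local_rep d f) (snd d p))"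
    by (rule partial_eqI)
  moreover have "partial j (\<lambda>x. local_rep d f (g x)) ?x = partial j (local_rep c f) ?x"
    by (rule partial_cong[OF atlas_open_overlap[OF c d] xS])
      (use c d in \<open>auto simp: gp local_rep_at\<close>)
  ultimately show ?thesis
    unfolding chart_partial_def g'_def by (simp add: sum_axis)
qed

lemma vector_field_transform:
  "w \<in> smooth_vector_fields A \<Longrightarrow> c \<in> A \<Longrightarrow> d \<in> A \<Longrightarrow> p \<in> fst c \<inter> fst d \<Longrightarrow>
    w d p $ i = (\<Sum>j\<in>UNIV. chart_partial c j (\<lambda>q. snd d q $ i) p * w c p $ j)"
  unfolding smooth_vector_fields_def by blast

lemma vector_field_smooth:
  "w \<in> smooth_vector_fields A \<Longrightarrow> c \<in> A \<Longrightarrow>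
    smooth_on (snd c ` fst c) (local_rep c (\<lambda>p. w c p $ i))"
  unfolding smooth_vector_fields_def by blast

lemma vderiv_chart_indep:
  assumes w: "w \<in> smooth_vector_fields A" and c: "c \<in> A" and d: "d \<in> A" and p: "p \<in> fst c \<inter> fst d"
    and f: "local_rep d f differentiable (at (snd d p))"
  shows "(\<Sum>j\<in>UNIV. w c p $ j * chart_partial c j f p) = (\<Sum>k\<in>UNIV. w d p $ k * chart_partial d k f p)"
proof -
  have "(\<Sum>j\<in>UNIV. w c p $ j * chart_partial c j f p) =
      (\<Sum>j\<in>UNIV. \<Sum>k\<in>UNIV. chart_partial c j (\<lambda>q. snd d q $ k) p * w c p $ j * chart_partial d k f p)"
    unfolding chart_partial_transform[OF c d p f] sum_distrib_left
    by (intro sum.cong refl) simp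
  also have "\<dots> = (\<Sum>k\<in>UNIV. w d p $ k * chart_partial d k f p)"
    unfolding vector_field_transform[OF w c d p] sum_distrib_right by (rule sum.swap)
  finally show ?thesis .
qed

lemma chart_at: "p \<in> topspace X \<Longrightarrow> chart_at A p \<in> A \<and> p \<in> fst (chart_at A p)"
  unfolding chart_at_def by (rule someI_ex) (use M in \<open>unfold smooth_manifold_def, blast\<close>)

theorem vderiv_in_chart:
  assumes w: "w \<in> smooth_vector_fields A" and f: "f \<in> smooth_functions A"
    and c: "c \<in> A" and p: "p \<in> fst c"
  shows "vderiv A w f p = (\<Sum>i\<in>UNIV. w c p $ i * chart_partial c i f p)"
proof -
  have "p \<in> topspace X" using c p M unfolding smooth_manifold_def by blast
  note b = chart_at[OF this]
  have "local_rep c f differentiable (at (snd c p))"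
    using f c p smooth_on_differentiable unfolding smooth_functions_def by blast
  then show ?thesis
    unfolding vderiv_def Let_def using b c p by (intro vderiv_chart_indep w) auto
qed

theorem vderiv_smooth:
  assumes w: "w \<in> smooth_vector_fields A" and f: "f \<in> smooth_functions A"
  shows "vderiv A w f \<in> smooth_functions A"
  unfolding smooth_functions_def
proof (intro CollectI ballI)
  fix c assume c: "c \<in> A"
  have fs: "smooth_on (snd c ` fst c) (local_rep c f)"
    using f c unfolding smooth_functions_def by blast
  have "smooth_on (snd c ` fst c)
      (\<lambda>x. \<Sum>i\<in>UNIV. local_rep c (\<lambda>p. w c p $ i) x * partial i (local_rep c f) x)"
    using atlas_open[OF c] fs vector_field_smooth[OF w c]
    by (intro smooth_on_sum smooth_on_mult smooth_on_partial) auto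
  then show "smooth_on (snd c ` fst c) (local_rep c (vderiv A w f))"
    by (rule smooth_on_cong[OF atlas_open[OF c], rotated])
      (use c in \<open>auto simp: local_rep_at vderiv_in_chart[OF w f c] chart_partial_def\<close>)
qed

lemma chart_partial_component:
  assumes v: "v \<in> smooth_vector_fields A" and c: "c \<in> A" and d: "d \<in> A" and p: "p \<in> fst c \<inter> fst d"
  shows "chart_partial c k (\<lambda>q. v d q $ i) p =
    (\<Sum>j\<in>UNIV. chart_partial c j (\<lambda>q. snd d q $ i) p * chart_partial c k (\<lambda>q. v c q $ j) p
      + partial k (partial j (local_rep c (\<lambda>q. snd d q $ i))) (snd c p) * v c p $ j)"
proof -
  let ?S = "snd c ` (fst c \<inter> fst d)"
  let ?t = "local_rep c (\<lambda>q. snd d q $ i)"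
  let ?v = "\<lambda>j. local_rep c (\<lambda>q. v c q $ j)"
  have xS: "snd c p \<in> ?S" using p by blast
  have t: "partial j ?t differentiable (at (snd c p))" for j
    by (rule smooth_on_differentiable[OF smooth_on_partial[OF atlas_smooth_transition[OF c d]] xS])
  have vd: "?v j differentiable (at (snd c p))" for j
    by (rule smooth_on_differentiable[OF vector_field_smooth[OF v c]]) (use p in blast)
  have "chart_partial c k (\<lambda>q. v d q $ i) p = partial k (\<lambda>x. \<Sum>j\<in>UNIV. partial j ?t x * ?v j x) (snd c p)"
    unfolding chart_partial_def
    by (rule partial_cong[OF atlas_open_overlap[OF c d] xS])
      (use c in \<open>auto simp: local_rep_at vector_field_transform[OF v c d] chart_partial_def\<close>)
  also have "\<dots> = (\<Sum>j\<in>UNIV. partial j ?t (snd c p) * partial k (?v j) (snd c p)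
      + partial k (partial j ?t) (snd c p) * ?v j (snd c p))"
    using t vd by (subst partial_sum) (auto simp: partial_mult)
  also have "\<dots> = (\<Sum>j\<in>UNIV. chart_partial c j (\<lambda>q. snd d q $ i) p * chart_partial c k (\<lambda>q. v c q $ j) p
      + partial k (partial j ?t) (snd c p) * v c p $ j)"
    using c p by (simp add: chart_partial_def local_rep_at)
  finally show ?thesis .
qed

theorem lie_bracket_vector_field:
  assumes u: "u \<in> smooth_vector_fields A" and v: "v \<in> smooth_vector_fields A"
  shows "lie_bracket u v \<in> smooth_vector_fields A"
proof -
  have "smooth_on (snd c ` fst c) (local_rep c (\<lambda>p. lie_bracket u v c p $ i))" if c: "c \<in> A" for c i
  proof -
    have "smooth_on (snd c ` fst c) (\<lambda>x. \<Sum>j\<in>UNIV.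
        local_rep c (\<lambda>p. u c p $ j) x * partial j (local_rep c (\<lambda>q. v c q $ i)) x
        - local_rep c (\<lambda>p. v c p $ j) x * partial j (local_rep c (\<lambda>q. u c q $ i)) x)"
      using atlas_open[OF c] vector_field_smooth[OF u c] vector_field_smooth[OF v c]
      by (intro smooth_on_sum smooth_on_diff smooth_on_mult smooth_on_partial) auto
    then show ?thesis
      by (rule smooth_on_cong[OF atlas_open[OF c], rotated])
        (use c in \<open>auto simp: local_rep_at lie_bracket_def chart_partial_def\<close>)
  qed
  moreover have "lie_bracket u v d p $ i =
      (\<Sum>j\<in>UNIV. chart_partial c j (\<lambda>q. snd d q $ i) p * lie_bracket u v c p $ j)"
    if c: "c \<in> A" and d: "d \<in> A" and p: "p \<in> fst c \<inter> fst d" for c d p i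
  proof -
    let ?J = "\<lambda>j. chart_partial c j (\<lambda>q. snd d q $ i) p"
    let ?H = "\<lambda>k j. partial k (partial j (local_rep c (\<lambda>q. snd d q $ i))) (snd c p)"
    have H: "?H k j = ?H j k" for k j
      using partial_commute[OF atlas_open_overlap[OF c d] _ atlas_smooth_transition[OF c d]] p by blast
    have *: "(\<Sum>k\<in>UNIV. a d p $ k * chart_partial d k (\<lambda>q. b d q $ i) p) =
        (\<Sum>k\<in>UNIV. \<Sum>j\<in>UNIV. ?J j * (a c p $ k * chart_partial c k (\<lambda>q. b c q $ j) p))
        + (\<Sum>k\<in>UNIV. \<Sum>j\<in>UNIV. ?H k j * a c p $ k * b c p $ j)"
      if a: "a \<in> smooth_vector_fields A" and b: "b \<in> smooth_vector_fields A" for a b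
    proof -
      have "local_rep d (\<lambda>q. b d q $ i) differentiable (at (snd d p))"
        by (rule smooth_on_differentiable[OF vector_field_smooth[OF b d]]) (use p in blast)
      from vderiv_chart_indep[OF a c d p this]
      have "(\<Sum>k\<in>UNIV. a d p $ k * chart_partial d k (\<lambda>q. b d q $ i) p) =
          (\<Sum>k\<in>UNIV. a c p $ k * chart_partial c k (\<lambda>q. b d q $ i) p)" by simp
      also have "\<dots> = (\<Sum>k\<in>UNIV. \<Sum>j\<in>UNIV. ?J j * (a c p $ k * chart_partial c k (\<lambda>q. b c q $ j) p)
          + ?H k j * a c p $ k * b c p $ j)"
        unfolding chart_partial_component[OF b c d p] sum_distrib_left
        by (intro sum.cong refl) (simp add: algebra_simps)
      finally show ?thesis by (simp add: sum.distrib)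
    qed
    have HH: "(\<Sum>k\<in>UNIV. \<Sum>j\<in>UNIV. ?H k j * u c p $ k * v c p $ j) =
        (\<Sum>k\<in>UNIV. \<Sum>j\<in>UNIV. ?H k j * v c p $ k * u c p $ j)"
      by (subst sum.swap) (intro sum.cong refl, subst H, simp)
    have "lie_bracket u v d p $ i =
        (\<Sum>k\<in>UNIV. \<Sum>j\<in>UNIV. ?J j * (u c p $ k * chart_partial c k (\<lambda>q. v c q $ j) p))
        - (\<Sum>k\<in>UNIV. \<Sum>j\<in>UNIV. ?J j * (v c p $ k * chart_partial c k (\<lambda>q. u c q $ j) p))"
      unfolding lie_bracket_def using *[OF u v] *[OF v u] HH by (simp add: sum_subtractf)
    also have "\<dots> = (\<Sum>k\<in>UNIV. \<Sum>j\<in>UNIV. ?J j * (u c p $ k * chart_partial c k (\<lambda>q. v c q $ j) p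
        - v c p $ k * chart_partial c k (\<lambda>q. u c q $ j) p))"
      by (simp add: sum_subtractf right_diff_distrib)
    also have "\<dots> = (\<Sum>j\<in>UNIV. ?J j * lie_bracket u v c p $ j)"
      unfolding lie_bracket_def by (subst sum.swap) (simp add: sum_distrib_left)
    finally show ?thesis .
  qed
  ultimately show ?thesis unfolding smooth_vector_fields_def by blast
qed

end


section \<open>The torus\<close>

definition torus :: "(complex^3) set" where
  "torus = {z. \<forall>i. cmod (z $ i) = 1}"

text \<open>The coordinates are angles; the chart with index \<open>a\<close> is centred at the point with angles \<open>a\<close>.\<close>

definition torus_chart :: "real^3 \<Rightarrow> (complex^3) chart" where
  "torus_chart a = ({z \<in> torus. \<forall>i. z $ i \<noteq> - cis (a $ i)},
     \<lambda>z. \<chi> i. a $ i + Arg (z $ i / cis (a $ i)))"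

definition torus_point :: "real^3 \<Rightarrow> complex^3" where
  "torus_point x = (\<chi> i. cis (x $ i))"

lemma continuous_on_torus_point: "continuous_on S torus_point"
  unfolding torus_point_def cis_conv_exp
  by (intro continuous_intros)

lemma torus_point_Arg: "z \<in> torus \<Longrightarrow> torus_point (\<chi> i. Arg (z $ i)) = z"
  unfolding torus_def torus_point_def
  by (auto simp: vec_eq_iff cis_conv_exp simp flip: complex_norm_eq_1_exp_eq)

lemma torus_point_in: "torus_point x \<in> torus"
  unfolding torus_def torus_point_def by simp

lemma Arg_cis_eq: "\<exists>n::int. Arg (cis t) = t + 2 * pi * n"
proof -
  have "cis (Arg (cis t)) = cis t" by (simp add: cis_Arg sgn_div_norm)
  then have "sin (Arg (cis t)) = sin t \<and> cos (Arg (cis t)) = cos t"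
    by (metis cis.sel)
  then show ?thesis using sin_cos_eq_iff by blast
qed

lemma Arg_unit_less_pi:
  assumes "cmod w = 1" "w \<noteq> -1"
  shows "\<bar>Arg w\<bar> < pi"
proof -
  have "Arg w \<noteq> pi"
  proof
    assume "Arg w = pi"
    moreover have "cis (Arg w) = w" using assms(1) by (metis cis_conv_exp complex_norm_eq_1_exp_eq)
    ultimately show False using assms(2) by simp
  qed
  then show ?thesis using mpi_less_Arg[of w] Arg_le_pi[of w] by linarith
qed

lemma cis_ne_minus:
  assumes "\<bar>t\<bar> < pi"
  shows "cis t \<noteq> -1"
proof
  assume "cis t = -1"
  moreover have "Arg (cis t) = t" using assms by (intro Arg_cis) auto
  moreover have "Arg (cis pi) = pi" by (intro Arg_cis) auto
  ultimately show False using assms by simp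
qed

lemma cis_ne_minus_cis: "cis s \<noteq> - cis t \<longleftrightarrow> cis (s - t) \<noteq> -1"
  by (simp add: cis_divide[symmetric] divide_eq_eq)

lemma torus_chart_inverse:
  assumes "z \<in> fst (torus_chart a)"
  shows "torus_point (snd (torus_chart a) z) = z" "\<And>i. \<bar>snd (torus_chart a) z $ i - a $ i\<bar> < pi"
proof -
  have z: "cmod (z $ i / cis (a $ i)) = 1" "z $ i / cis (a $ i) \<noteq> -1" for i
    using assms by (auto simp: torus_chart_def torus_def norm_divide divide_eq_eq)
  have "cis (a $ i) * cis (Arg (z $ i / cis (a $ i))) = z $ i" for i
  proof -
    have "z $ i / cis (a $ i) \<noteq> 0" using z(1)[of i] by force
    from cis_Arg[OF this] z(1)[of i] have "cis (Arg (z $ i / cis (a $ i))) = z $ i / cis (a $ i)"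
      by (simp add: sgn_div_norm)
    then show ?thesis by simp
  qed
  then show "torus_point (snd (torus_chart a) z) = z"
    by (simp add: torus_point_def torus_chart_def vec_eq_iff flip: cis_mult)
  show "\<bar>snd (torus_chart a) z $ i - a $ i\<bar> < pi" for i
    using Arg_unit_less_pi[OF z[of i]] by (simp add: torus_chart_def)
qed

lemma torus_chart_point:
  assumes "\<And>i. \<bar>x $ i - a $ i\<bar> < pi"
  shows "torus_point x \<in> fst (torus_chart a)" "snd (torus_chart a) (torus_point x) = x"
proof -
  have "cis (x $ i) \<noteq> - cis (a $ i)" for i
    unfolding cis_ne_minus_cis using assms[of i] by (intro cis_ne_minus)
  then show "torus_point x \<in> fst (torus_chart a)"
    using torus_point_in[of x] by (simp add: torus_chart_def torus_point_def)
  have "Arg (cis (x $ i) / cis (a $ i)) = x $ i - a $ i" for i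
  proof -
    have "Arg (cis (x $ i - a $ i)) = x $ i - a $ i"
      using assms[of i] by (intro Arg_cis) (auto simp: abs_less_iff)
    then show ?thesis by (simp add: cis_divide)
  qed
  then show "snd (torus_chart a) (torus_point x) = x"
    by (simp add: torus_chart_def torus_point_def vec_eq_iff)
qed

lemma torus_chart_image: "snd (torus_chart a) ` fst (torus_chart a) = {x. \<forall>i. \<bar>x $ i - a $ i\<bar> < pi}"
  (is "?L = ?R")
proof (intro equalityI subsetI)
  fix x assume "x \<in> ?L"
  then show "x \<in> ?R" using torus_chart_inverse(2) by auto
next
  fix x assume "x \<in> ?R"
  then have "torus_point x \<in> fst (torus_chart a)" "snd (torus_chart a) (torus_point x) = x"
    using torus_chart_point[of x a] by auto
  then show "x \<in> ?L" by (metis imageI)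
qed

lemma openin_torus_chart: "openin (top_of_set torus) (fst (torus_chart a))"
proof -
  have "open (\<Inter>i. {z::complex^3. z $ i \<noteq> - cis (a $ i)})"
    by (intro open_INT ballI open_Collect_neq continuous_intros) auto
  moreover have "fst (torus_chart a) = torus \<inter> (\<Inter>i. {z::complex^3. z $ i \<noteq> - cis (a $ i)})"
    by (auto simp: torus_chart_def)
  ultimately show ?thesis by (simp add: openin_open_Int)
qed

lemma continuous_on_torus_chart: "continuous_on (fst (torus_chart a)) (snd (torus_chart a))"
proof -
  have 1: "isCont Arg (z $ i / cis (a $ i))" if "z \<in> fst (torus_chart a)" for z i
  proof (rule continuous_at_Arg)
    let ?w = "z $ i / cis (a $ i)"
    have "cmod ?w = 1" "?w \<noteq> -1"
      using that by (auto simp: torus_chart_def torus_def norm_divide divide_eq_eq)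
    then show "?w \<notin> \<real>\<^sub>\<le>\<^sub>0" by (auto elim!: nonpos_Reals_cases)
  qed
  have 2: "isCont (\<lambda>z. z $ i / cis (a $ i)) z" for z :: "complex^3" and i
    by (intro continuous_intros) simp
  have "isCont (\<lambda>z. Arg (z $ i / cis (a $ i))) z" if "z \<in> fst (torus_chart a)" for z i
    by (rule isCont_o2[OF 2 1[OF that]])
  then have "continuous_on (fst (torus_chart a)) (\<lambda>z. Arg (z $ i / cis (a $ i)))" for i
    by (intro continuous_at_imp_continuous_on ballI)
  then have "continuous_on (fst (torus_chart a)) (\<lambda>z. \<chi> i. a $ i + Arg (z $ i / cis (a $ i)))"
    by (intro continuous_on_vec_lambda continuous_on_add continuous_on_const)
  then show ?thesis by (simp add: torus_chart_def)
qed

lemma chart_on_torus_chart: "chart_on (top_of_set torus) (torus_chart a)"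
proof -
  let ?U = "fst (torus_chart a)" and ?f = "snd (torus_chart a)"
  have sub: "?U \<subseteq> torus" by (auto simp: torus_chart_def)
  have "open (\<Inter>i. {x::real^3. \<bar>x $ i - a $ i\<bar> < pi})"
    by (intro open_INT ballI open_Collect_less continuous_intros) auto
  then have op: "open (?f ` ?U)" unfolding torus_chart_image by (simp add: Collect_all_eq)
  have "homeomorphic_maps (top_of_set ?U) (top_of_set (?f ` ?U)) ?f torus_point"
    unfolding homeomorphic_maps_def
    using continuous_on_torus_chart[of a] continuous_on_torus_point torus_chart_inverse[of _ a]
    by auto
  then have "homeomorphic_map (top_of_set ?U) (top_of_set (?f ` ?U)) ?f"
    by (rule homeomorphic_maps_imp_map)
  moreover have "subtopology (top_of_set torus) ?U = top_of_set ?U"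
    using sub by (simp add: subtopology_subtopology inf.absorb2)
  ultimately show ?thesis
    unfolding chart_on_def using op openin_torus_chart by simp
qed

lemma has_derivative_Arg_cis:
  fixes x :: "real^3"
  assumes "cis (x $ i - b) \<noteq> -1"
  shows "((\<lambda>y. b + Arg (cis (y $ i - b))) has_derivative (\<lambda>h. h $ i)) (at x)"
proof -
  obtain n :: int where n: "Arg (cis (x $ i - b)) = x $ i - b + 2 * pi * n"
    using Arg_cis_eq by blast
  define W where "W = {y::real^3. \<bar>y $ i - b + 2 * pi * n\<bar> < pi}"
  have W: "open W" unfolding W_def by (intro open_Collect_less continuous_intros)
  have xW: "x \<in> W" unfolding W_def using Arg_unit_less_pi[OF _ assms] n by simp
  have eq: "y $ i + 2 * pi * n = b + Arg (cis (y $ i - b))" if "y \<in> W" for y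
  proof -
    have "cis (y $ i - b + 2 * pi * n) = cis (y $ i - b)"
      by (simp add: cis_mult[symmetric])
    moreover have "Arg (cis (y $ i - b + 2 * pi * n)) = y $ i - b + 2 * pi * n"
      using that unfolding W_def by (intro Arg_cis) auto
    ultimately show ?thesis by simp
  qed
  have "((\<lambda>y. y $ i + 2 * pi * n) has_derivative (\<lambda>h. h $ i)) (at x)"
    using has_derivative_add[OF bounded_linear_imp_has_derivative[OF bounded_linear_vec_nth]
        has_derivative_const] by simp
  then show ?thesis by (rule has_derivative_transform_within_open[OF _ W xW eq])
qed

lemma smooth_on_Arg_cis:
  assumes S: "open S" "\<And>x. x \<in> S \<Longrightarrow> cis (x $ i - b) \<noteq> -1"
  shows "smooth_on S (\<lambda>y. b + Arg (cis (y $ i - b)))"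
  unfolding smooth_on_def
proof
  fix k
  let ?h = "\<lambda>y::real^3. b + Arg (cis (y $ i - b))"
  have d: "?h differentiable (at x)" if "x \<in> S" for x
    by (rule differentiableI[OF has_derivative_Arg_cis[OF S(2)[OF that]]])
  have e: "partial j ?h x = axis j 1 $ i" if "x \<in> S" for x j
    by (rule partial_eqI[OF has_derivative_Arg_cis[OF S(2)[OF that]]])
  have p: "Ck_on k S (partial j ?h)" for k j
    by (rule Ck_on_cong[OF S(1) _ Ck_on_const[of k S "axis j 1 $ i"]]) (simp add: e)
  have "Ck_on (Suc k) S ?h" using d p by simp
  then show "Ck_on k S ?h" by (rule Ck_on_Suc)
qed

theorem torus_compact_smooth_manifold:
  "compact_smooth_manifold (top_of_set torus) (range torus_chart)"
proof -
  have "torus = torus_point ` cbox (\<chi> i. -pi) (\<chi> i. pi)"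
  proof (intro equalityI subsetI)
    fix z assume z: "z \<in> torus"
    have "(\<chi> i. Arg (z $ i)) \<in> cbox (\<chi> i. -pi) (\<chi> i. pi)"
      using mpi_less_Arg Arg_le_pi by (auto simp: mem_box_cart less_imp_le)
    with torus_point_Arg[OF z] show "z \<in> torus_point ` cbox (\<chi> i. -pi) (\<chi> i. pi)"
      by (metis imageI)
  qed (auto simp: torus_point_in)
  then have "compact torus"
    using compact_continuous_image[OF continuous_on_torus_point compact_cbox] by metis
  then have "compact_space (top_of_set torus)"
    by (simp add: compact_space_subtopology)
  moreover have "Hausdorff_space (top_of_set torus)"
    by (simp add: Hausdorff_space_subtopology)
  moreover have "second_countable (euclidean :: (complex^3) topology)"
  proof -
    obtain B :: "(complex^3) set set" where "countable B" "\<And>C. C \<in> B \<Longrightarrow> open C"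
      "\<And>S. open S \<Longrightarrow> \<exists>U. U \<subseteq> B \<and> S = \<Union>U"
      using univ_second_countable by blast
    then show ?thesis unfolding second_countable_def open_openin[symmetric]
      by (intro exI[of _ B]) (metis Union_iff Sup_upper subsetD)
  qed
  then have "second_countable (top_of_set torus)" by (rule second_countable_subtopology)
  moreover have "(\<Union>c\<in>range torus_chart. fst c) = topspace (top_of_set torus)"
  proof (intro equalityI subsetI)
    fix z assume "z \<in> topspace (top_of_set torus)"
    then have z: "z \<in> torus" by simp
    have "torus_point (\<chi> i. Arg (z $ i)) \<in> fst (torus_chart (\<chi> i. Arg (z $ i)))"
      by (rule torus_chart_point) simp
    then show "z \<in> (\<Union>c\<in>range torus_chart. fst c)" using torus_point_Arg[OF z] by auto
  qed (auto simp: torus_chart_def)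
  moreover have "smooth_on (snd (torus_chart a) ` (fst (torus_chart a) \<inter> fst (torus_chart b)))
      (local_rep (torus_chart a) (\<lambda>p. snd (torus_chart b) p $ i))" for a b i
  proof -
    let ?S = "snd (torus_chart a) ` (fst (torus_chart a) \<inter> fst (torus_chart b))"
    have S: "open ?S" by (rule chart_on_open_image[OF chart_on_torus_chart openin_torus_chart])
    have "cis (x $ i - b $ i) \<noteq> -1" if x: "x \<in> ?S" for x
    proof -
      have "torus_point x \<in> fst (torus_chart b)" using x torus_chart_inverse(1)[of _ a] by auto
      then show ?thesis unfolding cis_ne_minus_cis[symmetric]
        by (simp add: torus_chart_def torus_point_def)
    qed
    note sm = smooth_on_Arg_cis[OF S this]
    show ?thesis
    proof (rule smooth_on_cong[OF S _ sm])
      fix x assume "x \<in> ?S"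
      then obtain z where z: "z \<in> fst (torus_chart a)" "x = snd (torus_chart a) z" by blast
      then have "inv_into (fst (torus_chart a)) (snd (torus_chart a)) x = torus_point x"
        using chart_on_inv[OF chart_on_torus_chart z(1)] torus_chart_inverse(1)[OF z(1)] by simp
      then show "b $ i + Arg (cis (x $ i - b $ i)) =
          local_rep (torus_chart a) (\<lambda>p. snd (torus_chart b) p $ i) x"
        by (simp add: local_rep_def) (simp add: torus_chart_def torus_point_def cis_divide)
    qed
  qed
  ultimately show ?thesis
    unfolding compact_smooth_manifold_def smooth_manifold_def
    using chart_on_torus_chart by auto
qed

end

theory Submission
  imports Defs
begin

text \<open>In a chart, the product rule (\<open>chart_partial_vderiv\<close>) splits T_u(T_v f)
  into a second-order part, the sum of u^k v^i d_k d_i f, and a first-order part, the sum of u^k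
  (d_k v^i) d_i f. Mixed partials commute (\<open>partial_commute\<close>), so the second-order part
  is symmetric in u and v and cancels in the commutator. What remains is first order, and its
  coefficient at d_i f is the i-th component of the bracket. One chart around the point suffices
  because neither side depends on the chart: \<open>vderiv_in_chart\<close> applies to the iterated
  derivatives by \<open>vderiv_smooth\<close> and to the bracket by
  \<open>lie_bracket_vector_field\<close>. The torus is an instance by
  \<open>torus_compact_smooth_manifold\<close>.\<close>

lemma chart_partial_vderiv:
  assumes M: "smooth_manifold X A"
    and w: "w \<in> smooth_vector_fields A" and f: "f \<in> smooth_functions A"
    and c: "c \<in> A" and p: "p \<in> fst c"
  shows "chart_partial c k (vderiv A w f) p =
    (\<Sum>i\<in>UNIV. w c p $ i * partial k (partial i (local_rep c f)) (snd c p)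
      + chart_partial c k (\<lambda>q. w c q $ i) p * chart_partial c i f p)"
proof -
  let ?S = "snd c ` fst c"
  let ?f = "local_rep c f"
  let ?w = "\<lambda>i. local_rep c (\<lambda>q. w c q $ i)"
  have x: "snd c p \<in> ?S" using p by blast
  have "smooth_on ?S ?f" using f c unfolding smooth_functions_def by blast
  then have f': "partial i ?f differentiable (at (snd c p))" for i
    using smooth_on_differentiable[OF smooth_on_partial x] by blast
  have w': "?w i differentiable (at (snd c p))" for i
    by (rule smooth_on_differentiable[OF vector_field_smooth[OF M w c] x])
  \<comment> \<open>\<open>vderiv\<close> may pick a different chart at every point. Differentiating
    it needs a formula valid on a whole neighbourhood of \<open>p\<close>;
    \<open>vderiv_in_chart\<close> gives one in the fixed chart \<open>c\<close>, on all of its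
    domain.\<close>
  have "chart_partial c k (vderiv A w f) p =
      partial k (\<lambda>x. \<Sum>i\<in>UNIV. ?w i x * partial i ?f x) (snd c p)"
    unfolding chart_partial_def
    by (rule partial_cong[OF atlas_open[OF M c] x])
      (use c in \<open>auto simp: local_rep_at[OF M] vderiv_in_chart[OF M w f c] chart_partial_def\<close>)
  also have "\<dots> = (\<Sum>i\<in>UNIV. ?w i (snd c p) * partial k (partial i ?f) (snd c p)
      + partial k (?w i) (snd c p) * partial i ?f (snd c p))"
    using f' w' by (subst partial_sum) (auto simp: partial_mult)
  finally show ?thesis
    using c p by (simp add: chart_partial_def local_rep_at[OF M])
qed

theorem theorem2p2:
  fixes X :: "'a topology" and A :: "'a chart set" and u v :: "'a vfield"
  assumes "compact_smooth_manifold X A"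
    and "u \<in> smooth_vector_fields A" and "v \<in> smooth_vector_fields A"
  shows "\<forall>f\<in>smooth_functions A. \<forall>p\<in>topspace X.
           commutator (vderiv A u) (vderiv A v) f p = vderiv A (lie_bracket u v) f p"
proof (intro ballI)
  fix f p
  assume f: "f \<in> smooth_functions A" and p: "p \<in> topspace X"
  have M: "smooth_manifold X A" using assms(1) unfolding compact_smooth_manifold_def by blast
  obtain c where c: "c \<in> A" "p \<in> fst c" using chart_at[OF M p] by blast
  let ?H = "\<lambda>k i. partial k (partial i (local_rep c f)) (snd c p)"
  \<comment> \<open>The first-order part, with \<open>i\<close> as the outer index: the inner sum is
    then the coefficient of the \<open>i\<close>-th partial of \<open>f\<close>, and
    \<open>?d u v - ?d v u\<close> matches the bracket term by term.\<close>
  let ?d = "\<lambda>a b. \<Sum>i\<in>UNIV. \<Sum>k\<in>UNIV.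
    a c p $ k * chart_partial c k (\<lambda>q. b c q $ i) p * chart_partial c i f p"
  have "smooth_on (snd c ` fst c) (local_rep c f)"
    using f c(1) unfolding smooth_functions_def by blast
  then have H: "?H k i = ?H i k" for k i
    using partial_commute[OF atlas_open[OF M c(1)]] c(2) by blast
  have second: "vderiv A a (vderiv A b f) p =
      (\<Sum>k\<in>UNIV. \<Sum>i\<in>UNIV. a c p $ k * b c p $ i * ?H k i) + ?d a b"
    if a: "a \<in> smooth_vector_fields A" and b: "b \<in> smooth_vector_fields A" for a b
  proof -
    have "vderiv A a (vderiv A b f) p =
        (\<Sum>k\<in>UNIV. \<Sum>i\<in>UNIV. a c p $ k * b c p $ i * ?H k i
          + a c p $ k * chart_partial c k (\<lambda>q. b c q $ i) p * chart_partial c i f p)"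
      unfolding vderiv_in_chart[OF M a vderiv_smooth[OF M b f] c]
        chart_partial_vderiv[OF M b f c] sum_distrib_left
      by (intro sum.cong refl) (simp add: algebra_simps)
    also have "\<dots> = (\<Sum>k\<in>UNIV. \<Sum>i\<in>UNIV. a c p $ k * b c p $ i * ?H k i) + ?d a b"
      unfolding sum.distrib by (intro arg_cong2[where f = "(+)"] refl sum.swap)
    finally show ?thesis .
  qed
  \<comment> \<open>Swapping the sums exchanges the roles of \<open>k\<close> and \<open>i\<close>;
    the symmetry \<open>H\<close> of the Hessian undoes this in \<open>?H\<close>, so only
    \<open>u\<close> and \<open>v\<close> trade places.\<close>
  have "(\<Sum>k\<in>UNIV. \<Sum>i\<in>UNIV. u c p $ k * v c p $ i * ?H k i) =
      (\<Sum>k\<in>UNIV. \<Sum>i\<in>UNIV. v c p $ k * u c p $ i * ?H k i)"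
    by (subst sum.swap) (intro sum.cong refl, subst H, simp)
  then have "commutator (vderiv A u) (vderiv A v) f p = ?d u v - ?d v u"
    unfolding commutator_def second[OF assms(2,3)] second[OF assms(3,2)] by simp
  also have "\<dots> = (\<Sum>i\<in>UNIV. lie_bracket u v c p $ i * chart_partial c i f p)"
    by (simp add: lie_bracket_def sum_distrib_right left_diff_distrib sum_subtractf)
  \<comment> \<open>The bracket obeys the transformation law of vector fields, so its components in
    \<open>c\<close> give the same value as those in the chart chosen by
    \<open>vderiv\<close>.\<close>
  also have "\<dots> = vderiv A (lie_bracket u v) f p"
    by (rule vderiv_in_chart[OF M lie_bracket_vector_field[OF M assms(2,3)] f c, symmetric])
  finally show "commutator (vderiv A u) (vderiv A v) f p = vderiv A (lie_bracket u v) f p" .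
qed

end
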